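(* Let $n\ge 2$ and let $\Gamma$ be the bijection from $n\times n$ alternating sign matrices to gog triangles of size $n$. Reversing the order of the rows of an $n\times n$ alternating sign matrix induces an involution $f=\Gamma\circ\mathrm{rev}\circ\Gamma^{-1}$ on the set $\mathcal{G}_n$ of gog triangles of size $n$, where $\mathrm{rev}$ denotes row reversal. Moreover, for every $G\in\mathcal{G}_n$, the two-color pyramid of $f(G)$ is obtained from the two-color pyramid of $G$ by reversing the color of every cube and moving each cube at position $(i,j,k)$ to position $(n-i,k,j)$.
   Context: An $n\times n$ alternating sign matrix is a matrix with entries in $\{0,1,-1\}$ such that each row and column sums to $1$ and the nonzero entries in each row and each column alternate in sign. A gog triangle of size $n$ is an array of positive integers $G(i,j)$, $1\le j\le i\le n$, such that $G(i,j)\le n-i+j$; $G(i,j)<G(i,j+1)$; $G(i,j)\ge G(i+1,j)$; and $G(i,j)\le G(i+1,j+1)$, whenever the entries are defined. The bijection $\Gamma$: for an ASM $A$ and each $i$, the sum of the first $i$ rows of $A$ is a $0$-$1$ vector with exactly $i$ ones, and row $i$ of $\Gamma(A)$ lists the positions of those ones in increasing order. The two-color pyramid of a gog triangle $G$ is the set of cube positions $(i,j,k)$ with $1\le j\le i\le n-1$ and $1\le k\le n-i$, where the cube at $(i,j,k)$ is white if $k\le G(i,j)-j$ and gray otherwise (i.e. the tower at $(i,j)$ has $G(i,j)-j$ white cubes stacked below $n-i-(G(i,j)-j)$ gray cubes; the last row of $G$ is always $1,2,\ldots,n$ and is omitted). *)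

theory Defs
  imports "Jordan_Normal_Form.Matrix"
begin

text \<open>
  Library matrices are indexed from \<open>0\<close>; gog triangles, cube positions and column
  positions are indexed from \<open>1\<close>.
\<close>

definition alternating_sign_list :: "int list \<Rightarrow> bool" where
  "alternating_sign_list xs \<longleftrightarrow>
     set xs \<subseteq> {0, 1, -1} \<and> sum_list xs = 1 \<and>
     successively (\<lambda>x y. sgn y = - sgn x) (filter (\<lambda>x. x \<noteq> 0) xs)"

definition ASM :: "nat \<Rightarrow> int mat set" where
  "ASM n = {A \<in> carrier_mat n n.
     (\<forall>i<n. alternating_sign_list (list_of_vec (row A i))) \<and>
     (\<forall>j<n. alternating_sign_list (list_of_vec (col A j)))}"

definition rev_rows :: "'a mat \<Rightarrow> 'a mat" where
  "rev_rows A = mat (dim_row A) (dim_col A) (\<lambda>(i, j). A $$ (dim_row A - 1 - i, j))"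

definition triangle :: "nat \<Rightarrow> (nat \<times> nat) set" where
  "triangle n = {(i, j). 1 \<le> j \<and> j \<le> i \<and> i \<le> n}"

text \<open>
  Triangular arrays are extensional functions on \<^term>\<open>triangle n\<close>, so that equality of
  functions is equality of arrays.
\<close>

definition Gog :: "nat \<Rightarrow> (nat \<times> nat \<Rightarrow> nat) set" where
  "Gog n = {G \<in> extensional (triangle n).
     (\<forall>(i, j) \<in> triangle n.
        1 \<le> G (i, j) \<and> G (i, j) \<le> n - i + j \<and>
        (j < i \<longrightarrow> G (i, j) < G (i, j + 1)) \<and>
        (i < n \<longrightarrow> G (i, j) \<ge> G (i + 1, j) \<and> G (i, j) \<le> G (i + 1, j + 1)))}"

definition partial_row_sum :: "int mat \<Rightarrow> nat \<Rightarrow> nat \<Rightarrow> int" where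
  "partial_row_sum A i c = (\<Sum>r<i. A $$ (r, c))"

definition ones_positions :: "nat \<Rightarrow> int mat \<Rightarrow> nat \<Rightarrow> nat set" where
  "ones_positions n A i = {p \<in> {1..n}. partial_row_sum A i (p - 1) = 1}"

definition Gamma :: "nat \<Rightarrow> int mat \<Rightarrow> (nat \<times> nat \<Rightarrow> nat)" where
  "Gamma n A = restrict (\<lambda>(i, j). sorted_list_of_set (ones_positions n A i) ! (j - 1)) (triangle n)"

definition gog_rev :: "nat \<Rightarrow> (nat \<times> nat \<Rightarrow> nat) \<Rightarrow> (nat \<times> nat \<Rightarrow> nat)" where
  "gog_rev n = Gamma n \<circ> rev_rows \<circ> inv_into (ASM n) (Gamma n)"

datatype color = White | Gray

fun opposite :: "color \<Rightarrow> color" where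
  "opposite White = Gray"
| "opposite Gray = White"

definition cubes :: "nat \<Rightarrow> (nat \<times> nat \<times> nat) set" where
  "cubes n = {(i, j, k). 1 \<le> j \<and> j \<le> i \<and> i \<le> n - 1 \<and> 1 \<le> k \<and> k \<le> n - i}"

text \<open>
  Truncated subtraction in \<open>G (i, j) - j\<close> is harmless because \<open>k \<ge> 1\<close> for every cube.
\<close>

definition cube_color :: "(nat \<times> nat \<Rightarrow> nat) \<Rightarrow> nat \<times> nat \<times> nat \<Rightarrow> color" where
  "cube_color G = (\<lambda>(i, j, k). if k \<le> G (i, j) - j then White else Gray)"

text \<open>A two-color pyramid is its set of cube positions, each paired with its color.\<close>

definition pyramid :: "nat \<Rightarrow> (nat \<times> nat \<Rightarrow> nat) \<Rightarrow> ((nat \<times> nat \<times> nat) \<times> color) set" where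
  "pyramid n G = (\<lambda>p. (p, cube_color G p)) ` cubes n"

end

theory Submission
  imports Defs
begin

text \<open>
  A list of integers is alternating exactly if its prefix sums lie in \<open>{0, 1}\<close> and its total
  is \<open>1\<close>. Hence an ASM is the same as a chain of sets \<open>S 0, \<dots>, S n\<close> (the positions of the
  ones in the sums of the first rows) with \<open>card (S i) = i\<close>: the column conditions say that the
  partial sums are indicator functions, the row conditions that the counting functions
  \<open>c \<mapsto> card (S i \<inter> {..c})\<close> of consecutive sets differ by \<open>0\<close> or \<open>1\<close>. Since the \<open>j\<close>-th element
  of \<open>S\<close> is at most \<open>c\<close> if and only if \<open>j \<le> card (S \<inter> {..c})\<close>, the latter is the interlacing
  condition of gog triangles. Reversing the rows replaces \<open>S i\<close> by the complement of \<open>S (n - i)\<close>.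
  If \<open>a\<close> is the \<open>j\<close>-th element of \<open>S i\<close> and \<open>b\<close> the \<open>k\<close>-th element of its complement, the cube
  at \<open>(i, j, k)\<close> is white in the original pyramid iff \<open>b < a\<close>, and the cube at \<open>(n - i, k, j)\<close>
  is white in the reversed one iff \<open>a < b\<close>.
\<close>

section \<open>Alternating lists and prefix sums\<close>

text \<open>
  The number \<open>2 * s - 1\<close> is the sign of the last nonzero entry seen before \<open>xs\<close> if the sum of
  the entries so far is \<open>s\<close>.
\<close>

lemma alternating_prefix_sums:
  fixes s :: int
  assumes "s \<in> {0, 1}"
  shows "(\<forall>k\<le>length xs. s + sum_list (take k xs) \<in> {0, 1}) \<longleftrightarrow>
    set xs \<subseteq> {0, 1, -1} \<and>
    successively (\<lambda>x y. sgn y = - sgn x) ((2 * s - 1) # filter (\<lambda>x. x \<noteq> 0) xs)"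
  using assms
proof (induction xs arbitrary: s)
  case Nil
  then show ?case by auto
next
  case (Cons x xs)
  have split: "(\<forall>k\<le>length (x # xs). s + sum_list (take k (x # xs)) \<in> {0, 1}) \<longleftrightarrow>
      s + x \<in> {0, 1} \<and> (\<forall>k\<le>length xs. (s + x) + sum_list (take k xs) \<in> {0, 1})"
    (is "?L \<longleftrightarrow> ?R")
  proof
    assume L: ?L
    have "(s + x) + sum_list (take k xs) \<in> {0, 1}" if "k \<le> length xs" for k
      using L[rule_format, of "Suc k"] that by (simp add: add.assoc)
    moreover from this[of 0] have "s + x \<in> {0, 1}" by simp
    ultimately show ?R by blast
  next
    assume R: ?R
    show ?L
    proof (intro allI impI)
      fix k assume "k \<le> length (x # xs)"
      then show "s + sum_list (take k (x # xs)) \<in> {0, 1}"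
        using R Cons.prems by (cases k) (auto simp: add.assoc)
    qed
  qed
  show ?case
  proof (cases "s + x \<in> {0, 1}")
    case True
    \<comment> \<open>A nonzero step flips the state \<open>s\<close>, so it is the opposite of the
      sign \<open>2 * s - 1\<close>; the sign that encodes the new state,
      \<open>2 * (s + x) - 1\<close>, is then \<open>x\<close> itself.\<close>
    then have x: "x = 0 \<or> x \<noteq> 0 \<and> x = 1 - 2 * s" using Cons.prems by auto
    from True split have "?thesis \<longleftrightarrow> ((set xs \<subseteq> {0, 1, -1} \<and>
        successively (\<lambda>x y. sgn y = - sgn x)
          ((2 * (s + x) - 1) # filter (\<lambda>x. x \<noteq> 0) xs)) \<longleftrightarrow>
        (set (x # xs) \<subseteq> {0, 1, -1} \<and>
        successively (\<lambda>x y. sgn y = - sgn x)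
          ((2 * s - 1) # filter (\<lambda>x. x \<noteq> 0) (x # xs))))"
      using Cons.IH[OF True] by simp
    also have "\<dots>" using x Cons.prems by auto
    finally show ?thesis by simp
  next
    case False
    then have "x \<noteq> 0" "sgn x \<noteq> - sgn (2 * s - 1) \<or> x \<notin> {0, 1, -1}"
      using Cons.prems by auto
    then show ?thesis using False split by auto
  qed
qed

text \<open>Alternation alone leaves the first sign open; the total 1 settles it. If the sign 1
  could precede the nonzero entries, the prefix sums started at 1 would stay in {0, 1} and the total
  would be at most 0.\<close>

lemma alternating_sign_list_iff_prefix_sums:
  "alternating_sign_list xs \<longleftrightarrow>
    (\<forall>k\<le>length xs. sum_list (take k xs) \<in> {0, 1}) \<and> sum_list xs = 1"
proof
  let ?alt = "successively (\<lambda>x y :: int. sgn y = - sgn x)"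
  let ?ys = "filter (\<lambda>x. x \<noteq> 0) xs"
  assume alt: "alternating_sign_list xs"
  then have xs: "set xs \<subseteq> {0, 1, -1}" "?alt ?ys" "sum_list xs = 1"
    by (auto simp: alternating_sign_list_def)
  have "\<not> ?alt (1 # ?ys)"
  proof
    assume "?alt (1 # ?ys)"
    then have "\<forall>k\<le>length xs. 1 + sum_list (take k xs) \<in> {0, 1}"
      using alternating_prefix_sums[of 1 xs] xs by simp
    from this[rule_format, of "length xs"] xs(3) show False by simp
  qed
  moreover have "set ?ys \<subseteq> {1, -1}" using xs(1) by auto
  ultimately have "?alt (-1 # ?ys)"
    using xs(2) by (cases ?ys) auto
  then show "(\<forall>k\<le>length xs. sum_list (take k xs) \<in> {0, 1}) \<and> sum_list xs = 1"
    using alternating_prefix_sums[of 0 xs] xs by simp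
next
  assume "(\<forall>k\<le>length xs. sum_list (take k xs) \<in> {0, 1}) \<and> sum_list xs = 1"
  then show "alternating_sign_list xs"
    using alternating_prefix_sums[of 0 xs]
    by (auto simp: alternating_sign_list_def successively_Cons)
qed

lemma alternating_sign_list_vec:
  "alternating_sign_list (list_of_vec v) \<longleftrightarrow>
    (\<forall>k\<le>dim_vec v. (\<Sum>i<k. v $ i) \<in> {0, 1}) \<and> (\<Sum>i<dim_vec v. v $ i) = 1"
proof -
  have len: "length (list_of_vec v) = dim_vec v" by simp
  have take: "sum_list (take k (list_of_vec v)) = (\<Sum>i<k. v $ i)" if "k \<le> dim_vec v" for k
    using that by (auto simp: sum_list_sum_nth atLeast0LessThan list_of_vec_index intro!: sum.cong)
  have "sum_list (list_of_vec v) = (\<Sum>i<dim_vec v. v $ i)"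
    using take[of "dim_vec v"] len by (metis order_refl take_all)
  then show ?thesis
    using take by (auto simp: alternating_sign_list_iff_prefix_sums)
qed

text \<open>Reversal swaps the arguments of the relation between neighbors, which is symmetric. This
  carries the column conditions through row reversal.\<close>

lemma alternating_sign_list_rev:
  "alternating_sign_list (rev xs) \<longleftrightarrow> alternating_sign_list xs"
proof -
  have "successively (\<lambda>x y :: int. sgn x = - sgn y) ys \<longleftrightarrow>
      successively (\<lambda>x y. sgn y = - sgn x) ys" for ys
    by (rule arg_cong[of _ _ "\<lambda>P. successively P ys"]) (intro ext, auto)
  then show ?thesis
    by (simp add: alternating_sign_list_def successively_rev flip: rev_filter)
qed

section \<open>Increasing enumerations and interlacing sets\<close>

text \<open>Only the indices \<open>1, ..., card S\<close> are constrained, so a row of a triangular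
  array can be used as it stands, whatever its values outside the triangle.\<close>

definition enumerates :: "(nat \<Rightarrow> nat) \<Rightarrow> nat set \<Rightarrow> bool" where
  "enumerates f S \<longleftrightarrow>
    finite S \<and> strict_mono_on {1..card S} f \<and> f ` {1..card S} = S"

text \<open>This Galois connection turns comparisons of elements into comparisons of counts. If
  \<open>f j\<close> is at most \<open>c\<close>, so are the \<open>j\<close> elements
  \<open>f 1, ..., f j\<close>; otherwise only indices below \<open>j\<close> can yield elements up
  to \<open>c\<close>.\<close>

lemma enumerates_le_iff:
  assumes "enumerates f S" "1 \<le> j" "j \<le> card S"
  shows "f j \<le> c \<longleftrightarrow> j \<le> card (S \<inter> {..c})"
proof
  from assms have fin: "finite S" and mono: "strict_mono_on {1..card S} f"
    and im: "f ` {1..card S} = S"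
    by (auto simp: enumerates_def)
  {
    assume le: "f j \<le> c"
    have "f x \<le> c" if "x \<in> {1..j}" for x
      using le strict_mono_onD[OF mono, of x j] that assms by (cases "x = j") auto
    then have "f ` {1..j} \<subseteq> S \<inter> {..c}"
      using im assms by auto
    then have "card (f ` {1..j}) \<le> card (S \<inter> {..c})"
      using fin by (intro card_mono) auto
    moreover have "inj_on f {1..j}"
      using assms by (intro inj_on_subset[OF strict_mono_on_imp_inj_on[OF mono]]) auto
    ultimately show "j \<le> card (S \<inter> {..c})"
      by (simp add: card_image)
  next
    assume le: "j \<le> card (S \<inter> {..c})"
    show "f j \<le> c"
    proof (rule ccontr)
      assume gt: "\<not> f j \<le> c"
      have "x < j" if "x \<in> {1..card S}" "f x \<le> c" for x
        using gt strict_mono_onD[OF mono, of j x] that assms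
        by (cases x j rule: linorder_cases) auto
      then have "S \<inter> {..c} \<subseteq> f ` {1..<j}"
        using im by force
      then have "card (S \<inter> {..c}) \<le> card {1..<j}"
        by (rule surj_card_le[rotated]) simp
      then show False using le assms by simp
    qed
  }
qed

lemma enumerates_card_atMost:
  assumes "enumerates f S" "1 \<le> j" "j \<le> card S"
  shows "card (S \<inter> {..f j}) = j"
proof (rule antisym)
  show "j \<le> card (S \<inter> {..f j})"
    using enumerates_le_iff[OF assms, of "f j"] by simp
  show "card (S \<inter> {..f j}) \<le> j"
  proof (rule ccontr)
    assume less: "\<not> card (S \<inter> {..f j}) \<le> j"
    have "card (S \<inter> {..f j}) \<le> card S"
      using assms by (intro card_mono) (auto simp: enumerates_def)
    with less have "f (Suc j) \<le> f j"
      using enumerates_le_iff[OF assms(1), of "Suc j"] by simp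
    moreover have "f j < f (Suc j)"
      using assms less \<open>card (S \<inter> {..f j}) \<le> card S\<close>
        strict_mono_onD[of "{1..card S}" f j "Suc j"]
      by (auto simp: enumerates_def)
    ultimately show False by simp
  qed
qed

lemma enumerates_mem:
  assumes "enumerates f S" "1 \<le> j" "j \<le> card S"
  shows "f j \<in> S"
  using assms by (auto simp: enumerates_def)

lemma enumerates_unique:
  assumes "enumerates f S" "enumerates g S" "1 \<le> j" "j \<le> card S"
  shows "f j = g j"
  using enumerates_le_iff[OF assms(1,3,4)] enumerates_le_iff[OF assms(2,3,4)]
  by (metis order_antisym order_refl)

lemma enumerates_sorted_list_of_set:
  assumes "finite S"
  shows "enumerates (\<lambda>j. sorted_list_of_set S ! (j - 1)) S"
  unfolding enumerates_def
proof (intro conjI assms)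
  show "strict_mono_on {1..card S} (\<lambda>j. sorted_list_of_set S ! (j - 1))"
  proof (rule strict_mono_onI)
    fix a b assume "a \<in> {1..card S}" "b \<in> {1..card S}" "a < b"
    then have "a - 1 < b - 1" "b - 1 < length (sorted_list_of_set S)" by auto
    then show "sorted_list_of_set S ! (a - 1) < sorted_list_of_set S ! (b - 1)"
      by (rule sorted_wrt_nth_less[OF strict_sorted_list_of_set])
  qed
  have "(\<lambda>j. sorted_list_of_set S ! (j - 1)) ` {1..card S} =
      (!) (sorted_list_of_set S) ` (\<lambda>j. j - 1) ` {1..card S}"
    by (simp add: image_image)
  also have "(\<lambda>j. j - 1) ` {1..card S} = {..<card S}"
    by (force simp: image_iff intro: bexI[of _ "Suc _"])
  also have "(!) (sorted_list_of_set S) ` {..<card S} = set (sorted_list_of_set S)"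
    by (auto simp: set_conv_nth)
  finally show "(\<lambda>j. sorted_list_of_set S ! (j - 1)) ` {1..card S} = S"
    using assms by simp
qed

text \<open>This counting form is what the row prefix sums of a matrix express;
  \<open>interlacing_iff_enumerations\<close> converts it into the inequalities of gog
  triangles.\<close>

definition interlacing :: "nat set \<Rightarrow> nat set \<Rightarrow> bool" where
  "interlacing S T \<longleftrightarrow> (\<forall>c. card (S \<inter> {..c}) \<le> card (T \<inter> {..c}) \<and>
     card (T \<inter> {..c}) \<le> Suc (card (S \<inter> {..c})))"

lemma interlacing_iff_enumerations:
  assumes f: "enumerates f S" and g: "enumerates g T" and card: "card T = Suc (card S)"
  shows "interlacing S T \<longleftrightarrow> (\<forall>j\<in>{1..card S}. g j \<le> f j \<and> f j \<le> g (Suc j))"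
proof
  assume inter: "interlacing S T"
  show "\<forall>j\<in>{1..card S}. g j \<le> f j \<and> f j \<le> g (Suc j)"
  proof
    fix j assume "j \<in> {1..card S}"
    then have j: "1 \<le> j" "j \<le> card S" by auto
    \<comment> \<open>Counting at \<open>c = f j\<close> gives the first inequality, counting at
      \<open>c = g (Suc j)\<close> the second.\<close>
    have "j = card (S \<inter> {..f j})"
      using enumerates_card_atMost[OF f j] by simp
    also have "\<dots> \<le> card (T \<inter> {..f j})"
      using inter by (auto simp: interlacing_def)
    finally have "g j \<le> f j"
      using enumerates_le_iff[OF g, of j "f j"] j card by simp
    moreover have "Suc j = card (T \<inter> {..g (Suc j)})"
      using enumerates_card_atMost[OF g, of "Suc j"] j card by simp
    then have "Suc j \<le> Suc (card (S \<inter> {..g (Suc j)}))"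
      using inter by (metis interlacing_def)
    then have "f j \<le> g (Suc j)"
      using enumerates_le_iff[OF f j] by simp
    ultimately show "g j \<le> f j \<and> f j \<le> g (Suc j)" ..
  qed
next
  assume le: "\<forall>j\<in>{1..card S}. g j \<le> f j \<and> f j \<le> g (Suc j)"
  have "card (S \<inter> {..c}) \<le> card (T \<inter> {..c})" for c
  proof (cases "card (S \<inter> {..c}) = 0")
    case False
    \<comment> \<open>The last element of \<open>S\<close> up to \<open>c\<close> is
      \<open>f j\<close>; as \<open>g j\<close> is no larger, \<open>T\<close> has at least
      \<open>j\<close> elements up to \<open>c\<close>.\<close>
    define j where "j = card (S \<inter> {..c})"
    have "1 \<le> j" using False unfolding j_def by linarith
    moreover have "j \<le> card S"
      using f unfolding j_def by (intro card_mono) (auto simp: enumerates_def)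
    ultimately have j: "1 \<le> j" "j \<le> card S" .
    have "f j \<le> c" using enumerates_le_iff[OF f j] by (simp add: j_def)
    moreover have "g j \<le> f j" using le j by simp
    ultimately have "g j \<le> c" by simp
    then show ?thesis
      using enumerates_le_iff[OF g, of j c] j card by (simp add: j_def)
  qed auto
  moreover have "card (T \<inter> {..c}) \<le> Suc (card (S \<inter> {..c}))" for c
  proof (cases "card (T \<inter> {..c}) \<le> 1")
    case False
    \<comment> \<open>A count of at most 1 meets the bound trivially. Otherwise the last element of
      \<open>T\<close> up to \<open>c\<close> is \<open>g (Suc j)\<close>, and \<open>f j\<close>
      does not exceed it.\<close>
    then obtain j where Suc_j: "card (T \<inter> {..c}) = Suc j" and "1 \<le> j"
      by (cases "card (T \<inter> {..c})") auto
    have "card (T \<inter> {..c}) \<le> card T"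
      using g by (auto simp: enumerates_def intro!: card_mono)
    then have j: "1 \<le> j" "j \<le> card S" using Suc_j \<open>1 \<le> j\<close> card by auto
    have "g (Suc j) \<le> c"
      using enumerates_le_iff[OF g, of "Suc j" c] j card Suc_j by simp
    moreover have "f j \<le> g (Suc j)" using le j by simp
    ultimately have "f j \<le> c" by simp
    then show ?thesis
      using enumerates_le_iff[OF f j] Suc_j by simp
  qed auto
  ultimately show "interlacing S T" by (auto simp: interlacing_def)
qed

text \<open>Column \<open>c'\<close> of a matrix carries position \<open>Suc c'\<close>, so the
  first \<open>c\<close> columns carry the positions \<open>1, ..., c\<close>.\<close>

lemma sum_of_bool_eq_card_atMost:
  assumes "0 \<notin> S"
  shows "(\<Sum>c'<c. of_bool (Suc c' \<in> S)) = int (card (S \<inter> {..c}))"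
proof (induction c)
  case 0
  then show ?case using assms by simp
next
  case (Suc c)
  have "S \<inter> {..Suc c} = (if Suc c \<in> S then insert (Suc c) (S \<inter> {..c}) else S \<inter> {..c})"
    by (auto simp: le_Suc_eq)
  then show ?case using Suc by simp
qed

section \<open>Alternating sign matrices as interlacing chains\<close>

lemma ASM_iff_sums:
  "A \<in> ASM n \<longleftrightarrow> A \<in> carrier_mat n n \<and>
    (\<forall>i<n. (\<forall>c\<le>n. (\<Sum>c'<c. A $$ (i, c')) \<in> {0, 1}) \<and> (\<Sum>c'<n. A $$ (i, c')) = 1) \<and>
    (\<forall>c<n. (\<forall>i\<le>n. partial_row_sum A i c \<in> {0, 1}) \<and> partial_row_sum A n c = 1)"
proof (cases "A \<in> carrier_mat n n")
  case True
  then have "(\<Sum>c'<c. row A i $ c') = (\<Sum>c'<c. A $$ (i, c'))" if "i < n" "c \<le> n" for i c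
    using that by (intro sum.cong) auto
  moreover have "(\<Sum>r<i. col A c $ r) = partial_row_sum A i c" if "i \<le> n" "c < n" for i c
    using that True by (auto simp: partial_row_sum_def intro!: sum.cong)
  ultimately show ?thesis
    using True by (simp add: ASM_def alternating_sign_list_vec)
qed (simp add: ASM_def)

lemma row_sum_eq_card_diff:
  assumes "A \<in> carrier_mat n n" "0 \<notin> S i" "0 \<notin> S (Suc i)" "i < n" "c \<le> n"
    and S: "\<And>i c. i \<le> n \<Longrightarrow> c < n \<Longrightarrow> partial_row_sum A i c = of_bool (Suc c \<in> S i)"
  shows "(\<Sum>c'<c. A $$ (i, c')) = int (card (S (Suc i) \<inter> {..c})) - int (card (S i \<inter> {..c}))"
proof -
  have "A $$ (i, c') = of_bool (Suc c' \<in> S (Suc i)) - of_bool (Suc c' \<in> S i)" if "c' < c" for c'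
  proof -
    have "A $$ (i, c') = partial_row_sum A (Suc i) c' - partial_row_sum A i c'"
      by (simp add: partial_row_sum_def)
    then show ?thesis using S[of "Suc i" c'] S[of i c'] assms that by simp
  qed
  then have "(\<Sum>c'<c. A $$ (i, c')) =
      (\<Sum>c'<c. of_bool (Suc c' \<in> S (Suc i)) - of_bool (Suc c' \<in> S i))"
    by (intro sum.cong) auto
  also have "\<dots> = int (card (S (Suc i) \<inter> {..c})) - int (card (S i \<inter> {..c}))"
    using assms sum_of_bool_eq_card_atMost[of "S i" c] sum_of_bool_eq_card_atMost[of "S (Suc i)" c]
    by (simp add: sum_subtractf)
  finally show ?thesis .
qed

text \<open>Stated for any sets whose indicators are the partial row sums, so that it serves both to
  analyze a given ASM and to verify the matrix built from a gog triangle. Row prefixes give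
  interlacing, row totals the growth of the cardinality by 1, and the column conditions
  follow.\<close>

lemma ASM_iff_interlacing:
  assumes A: "A \<in> carrier_mat n n"
    and sub: "\<And>i. i \<le> n \<Longrightarrow> S i \<subseteq> {1..n}"
    and S: "\<And>i c. i \<le> n \<Longrightarrow> c < n \<Longrightarrow> partial_row_sum A i c = of_bool (Suc c \<in> S i)"
  shows "A \<in> ASM n \<longleftrightarrow>
    (\<forall>i\<le>n. card (S i) = i) \<and> (\<forall>i<n. interlacing (S i) (S (Suc i)))"
proof -
  have cut: "S i \<inter> {..c} = S i" if "i \<le> n" "n \<le> c" for i c
    using sub[of i] that by force
  have row: "(\<Sum>c'<c. A $$ (i, c')) = int (card (S (Suc i) \<inter> {..c})) - int (card (S i \<inter> {..c}))"
    if "i < n" "c \<le> n" for i c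
  proof (rule row_sum_eq_card_diff[where n = n])
    show "0 \<notin> S i" "0 \<notin> S (Suc i)" using sub[of i] sub[of "Suc i"] that by auto
  qed (use A S that in auto)
  have total: "(\<Sum>c'<n. A $$ (i, c')) = int (card (S (Suc i))) - int (card (S i))" if "i < n" for i
    using row[of i n] cut[of i n] cut[of "Suc i" n] that by simp
  have prefix: "(\<forall>c\<le>n. (\<Sum>c'<c. A $$ (i, c')) \<in> {0, 1}) \<longleftrightarrow> interlacing (S i) (S (Suc i))"
    if "i < n" for i
  proof -
    have "(\<forall>c\<le>n. (\<Sum>c'<c. A $$ (i, c')) \<in> {0, 1}) \<longleftrightarrow>
        (\<forall>c\<le>n. card (S i \<inter> {..c}) \<le> card (S (Suc i) \<inter> {..c}) \<and>
          card (S (Suc i) \<inter> {..c}) \<le> Suc (card (S i \<inter> {..c})))"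
      using row[OF that] by auto
    also have "\<dots> \<longleftrightarrow> interlacing (S i) (S (Suc i))"
    proof -
      \<comment> \<open>All positions are at most \<open>n\<close>, so the counts are constant from
        \<open>c = n\<close> on.\<close>
      have "S i \<inter> {..c} = S i \<inter> {..min c n}" "S (Suc i) \<inter> {..c} = S (Suc i) \<inter> {..min c n}" for c
        using sub[of i] sub[of "Suc i"] that by force+
      then show ?thesis
        unfolding interlacing_def by (metis min.cobounded2)
    qed
    finally show ?thesis .
  qed
  \<comment> \<open>The empty sum of rows vanishes, which anchors the cardinalities at 0.\<close>
  have "S 0 = {}"
  proof -
    have "Suc c \<notin> S 0" if "c < n" for c
      using S[of 0 c] that by (simp add: partial_row_sum_def of_bool_def split: if_splits)
    then have "x \<notin> S 0" for x using sub[of 0] by (cases x) force+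
    then show ?thesis by blast
  qed
  have "(\<forall>i<n. card (S (Suc i)) = Suc (card (S i))) \<longleftrightarrow> (\<forall>i\<le>n. card (S i) = i)"
  proof
    assume step: "\<forall>i<n. card (S (Suc i)) = Suc (card (S i))"
    have "i \<le> n \<Longrightarrow> card (S i) = i" for i
      using step \<open>S 0 = {}\<close> by (induction i) auto
    then show "\<forall>i\<le>n. card (S i) = i" by blast
  qed auto
  moreover have "(\<Sum>c'<n. A $$ (i, c')) = 1 \<longleftrightarrow> card (S (Suc i)) = Suc (card (S i))" if "i < n" for i
    using total[OF that] by linarith
  moreover have "partial_row_sum A n c = 1" if "card (S n) = n" "c < n" for c
  proof -
    \<comment> \<open>A subset of \<open>{1..n}\<close> with \<open>n\<close> elements exhausts it,
      so every column has total 1.\<close>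
    have "S n = {1..n}"
      using that sub[of n] by (intro card_subset_eq) auto
    then show ?thesis using S[of n c] that by simp
  qed
  moreover have "partial_row_sum A i c \<in> {0, 1}" if "i \<le> n" "c < n" for i c
    using S[OF that] by simp
  ultimately show ?thesis
    using A prefix unfolding ASM_iff_sums by auto
qed

lemma ones_positions_subset: "ones_positions n A i \<subseteq> {1..n}"
  by (auto simp: ones_positions_def)

lemma finite_ones_positions: "finite (ones_positions n A i)"
  using finite_subset[OF ones_positions_subset] by blast

lemma partial_row_sum_eq_of_bool:
  assumes "A \<in> ASM n" "i \<le> n" "c < n"
  shows "partial_row_sum A i c = of_bool (Suc c \<in> ones_positions n A i)"
proof -
  have "partial_row_sum A i c \<in> {0, 1}"
    using assms by (auto simp: ASM_iff_sums)
  then show ?thesis using assms(3) by (auto simp: ones_positions_def)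
qed

lemma ASM_ones_positions:
  assumes "A \<in> ASM n"
  shows "i \<le> n \<Longrightarrow> card (ones_positions n A i) = i"
    and "i < n \<Longrightarrow> interlacing (ones_positions n A i) (ones_positions n A (Suc i))"
  using assms ASM_iff_interlacing[of A n "ones_positions n A"] ones_positions_subset[of n A]
    partial_row_sum_eq_of_bool[OF assms]
  by (auto simp: ASM_def)

section \<open>The bijection with gog triangles\<close>

lemma GogI:
  assumes G: "G \<in> extensional (triangle n)"
    and enum: "\<And>i. i \<le> n \<Longrightarrow> enumerates (\<lambda>j. G (i, j)) (S i)"
    and sub: "\<And>i. i \<le> n \<Longrightarrow> S i \<subseteq> {1..n}"
    and card: "\<And>i. i \<le> n \<Longrightarrow> card (S i) = i"
    and inter: "\<And>i. i < n \<Longrightarrow> interlacing (S i) (S (Suc i))"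
  shows "G \<in> Gog n"
proof -
  have "1 \<le> G (i, j) \<and> G (i, j) \<le> n - i + j \<and> (j < i \<longrightarrow> G (i, j) < G (i, j + 1)) \<and>
        (i < n \<longrightarrow> G (i, j) \<ge> G (i + 1, j) \<and> G (i, j) \<le> G (i + 1, j + 1))"
    if "(i, j) \<in> triangle n" for i j
  proof (intro conjI impI)
    from that have ij: "1 \<le> j" "j \<le> i" "i \<le> n" by (auto simp: triangle_def)
    show "1 \<le> G (i, j)"
      using enumerates_mem[OF enum[OF ij(3)], of j] sub[of i] card[of i] ij by auto
    \<comment> \<open>Only \<open>i - j\<close> positions exceed \<open>n - i + j\<close>, which
      leaves at least \<open>j\<close> of the \<open>i\<close> elements of \<open>S i\<close> up to
      that bound.\<close>
    have "S i - {..n - i + j} \<subseteq> {n - i + j<..n}" using sub[OF ij(3)] by auto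
    then have "card (S i - {..n - i + j}) \<le> card {n - i + j<..n}" by (intro card_mono) auto
    moreover have "card (S i) \<le> card (S i \<inter> {..n - i + j}) + card (S i - {..n - i + j})"
      by (metis Int_Diff_Un card_Un_le)
    ultimately have "j \<le> card (S i \<inter> {..n - i + j})"
      using ij card[of i] by simp
    then show "G (i, j) \<le> n - i + j"
      using enumerates_le_iff[OF enum[OF ij(3)], of j] card[of i] ij by simp
    show "G (i, j) < G (i, j + 1)" if "j < i"
      using enum[OF ij(3)] strict_mono_onD[of "{1..card (S i)}" "\<lambda>j. G (i, j)" j "j + 1"]
        card[of i] ij that
      by (auto simp: enumerates_def)
    assume "i < n"
    then have "\<forall>j\<in>{1..card (S i)}. G (Suc i, j) \<le> G (i, j) \<and> G (i, j) \<le> G (Suc i, Suc j)"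
      using interlacing_iff_enumerations[OF enum[of i] enum[of "Suc i"]] card[of i] card[of "Suc i"]
        inter[of i]
      by simp
    then show "G (i + 1, j) \<le> G (i, j)" "G (i, j) \<le> G (i + 1, j + 1)"
      using ij card[of i] by auto
  qed
  then show ?thesis using G by (auto simp: Gog_def)
qed

lemma Gog_rows:
  fixes S :: "nat \<Rightarrow> nat set"
  assumes G: "G \<in> Gog n"
  defines "S \<equiv> (\<lambda>i. (\<lambda>j. G (i, j)) ` {1..i})"
  shows "i \<le> n \<Longrightarrow> S i \<subseteq> {1..n}"
    and "i \<le> n \<Longrightarrow> card (S i) = i"
    and "i \<le> n \<Longrightarrow> enumerates (\<lambda>j. G (i, j)) (S i)"
    and "i < n \<Longrightarrow> interlacing (S i) (S (Suc i))"
proof -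
  have tri: "1 \<le> G (i, j)" "G (i, j) \<le> n - i + j" "j < i \<Longrightarrow> G (i, j) < G (i, Suc j)"
      "i < n \<Longrightarrow> G (Suc i, j) \<le> G (i, j)" "i < n \<Longrightarrow> G (i, j) \<le> G (Suc i, Suc j)"
    if "1 \<le> j" "j \<le> i" "i \<le> n" for i j
    using G that by (auto simp: Gog_def triangle_def)
  have mono: "strict_mono_on {1..i} (\<lambda>j. G (i, j))" if "i \<le> n" for i
  proof -
    have "G (i, a) < G (i, b)" if "a < b" "1 \<le> a" "b \<le> i" for a b
      using that
    proof (induction b)
      case (Suc b)
      then show ?case using tri(3)[of b i] \<open>i \<le> n\<close> by (cases "a = b") auto
    qed simp
    then show ?thesis by (auto simp: strict_mono_on_def)
  qed
  show sub: "S i \<subseteq> {1..n}" if "i \<le> n" for i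
    using tri(1,2)[of _ i] that by (fastforce simp: S_def)
  show card: "card (S i) = i" if "i \<le> n" for i
    using card_image[OF strict_mono_on_imp_inj_on[OF mono[OF that]]] by (simp add: S_def)
  show enum: "enumerates (\<lambda>j. G (i, j)) (S i)" if "i \<le> n" for i
    using mono[OF that] card[OF that] by (auto simp: enumerates_def S_def)
  show "interlacing (S i) (S (Suc i))" if "i < n" for i
    using interlacing_iff_enumerations[OF enum[of i] enum[of "Suc i"]] tri(4,5) card that by auto
qed

lemma Gamma_enumerates:
  assumes "A \<in> ASM n" "i \<le> n"
  shows "enumerates (\<lambda>j. Gamma n A (i, j)) (ones_positions n A i)"
proof -
  let ?S = "ones_positions n A i"
  have "Gamma n A (i, j) = sorted_list_of_set ?S ! (j - 1)" if "j \<in> {1..card ?S}" for j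
    using that assms(2) ASM_ones_positions(1)[OF assms] by (auto simp: Gamma_def triangle_def)
  moreover have "enumerates (\<lambda>j. sorted_list_of_set ?S ! (j - 1)) ?S"
    by (rule enumerates_sorted_list_of_set[OF finite_ones_positions])
  ultimately show ?thesis
    by (auto simp: enumerates_def strict_mono_on_def image_def)
qed

lemma Gamma_in_Gog:
  assumes "A \<in> ASM n"
  shows "Gamma n A \<in> Gog n"
  using Gamma_enumerates[OF assms] ones_positions_subset ASM_ones_positions[OF assms]
  by (intro GogI[where S = "ones_positions n A"]) (auto simp: Gamma_def)

text \<open>The triangle determines the sets of ones, these the partial row sums, and successive
  differences of the latter the entries.\<close>

lemma inj_on_Gamma: "inj_on (Gamma n) (ASM n)"
proof (rule inj_onI)
  fix A B assume A: "A \<in> ASM n" and B: "B \<in> ASM n" and eq: "Gamma n A = Gamma n B"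
  have "ones_positions n A i = ones_positions n B i" if "i \<le> n" for i
  proof -
    have "ones_positions n A i = (\<lambda>j. Gamma n A (i, j)) ` {1..i}"
      using Gamma_enumerates[OF A that] ASM_ones_positions(1)[OF A that]
      by (simp add: enumerates_def)
    moreover have "ones_positions n B i = (\<lambda>j. Gamma n B (i, j)) ` {1..i}"
      using Gamma_enumerates[OF B that] ASM_ones_positions(1)[OF B that]
      by (simp add: enumerates_def)
    ultimately show ?thesis by (simp add: eq)
  qed
  then have sums: "partial_row_sum A i c = partial_row_sum B i c" if "i \<le> n" "c < n" for i c
    using partial_row_sum_eq_of_bool[OF A that] partial_row_sum_eq_of_bool[OF B that] that by simp
  have carrier: "A \<in> carrier_mat n n" "B \<in> carrier_mat n n"
    using A B by (auto simp: ASM_def)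
  show "A = B"
  proof (rule eq_matI)
    fix i c assume "i < dim_row B" "c < dim_col B"
    then have "i < n" "c < n" using carrier by auto
    then show "A $$ (i, c) = B $$ (i, c)"
      using sums[of i c] sums[of "Suc i" c] by (simp add: partial_row_sum_def)
  qed (use carrier in auto)
qed

lemma Gog_subset_range_Gamma:
  assumes G: "G \<in> Gog n"
  shows "G \<in> Gamma n ` ASM n"
proof -
  define S where "S i = (\<lambda>j. G (i, j)) ` {1..i}" for i
  note rows = Gog_rows[OF G, folded S_def]
  \<comment> \<open>The preimage of \<open>G\<close>: row \<open>i\<close> is what turns the
    indicator of \<open>S i\<close> into that of \<open>S (Suc i)\<close>. As \<open>S 0\<close> is
    empty, the partial sums telescope to the indicators.\<close>
  define A :: "int mat" where
    "A = mat n n (\<lambda>(i, c). of_bool (Suc c \<in> S (Suc i)) - of_bool (Suc c \<in> S i))"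
  have carrier: "A \<in> carrier_mat n n" by (simp add: A_def)
  have sums: "partial_row_sum A i c = of_bool (Suc c \<in> S i)" if "i \<le> n" "c < n" for i c
    using that
  proof (induction i)
    case 0
    then show ?case by (simp add: partial_row_sum_def S_def)
  next
    case (Suc i)
    then show ?case by (simp add: partial_row_sum_def A_def)
  qed
  have A: "A \<in> ASM n"
    using ASM_iff_interlacing[OF carrier rows(1) sums] rows(2,4) by auto
  have ones: "ones_positions n A i = S i" if "i \<le> n" for i
  proof -
    have "p \<in> ones_positions n A i \<longleftrightarrow> p \<in> S i" if "p \<in> {1..n}" for p
      using sums[OF \<open>i \<le> n\<close>, of "p - 1"] that by (auto simp: ones_positions_def)
    then show ?thesis using ones_positions_subset[of n A i] rows(1)[OF that] by blast
  qed
  have "Gamma n A = G"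
  proof (rule extensionalityI)
    fix p assume "p \<in> triangle n"
    then obtain i j where p: "p = (i, j)" "1 \<le> j" "j \<le> i" "i \<le> n" by (auto simp: triangle_def)
    then have "enumerates (\<lambda>j. Gamma n A (i, j)) (S i)"
      using Gamma_enumerates[OF A, of i] ones[of i] by simp
    then show "Gamma n A p = G p"
      using enumerates_unique[OF _ rows(3)[of i]] rows(2)[of i] p by auto
  qed (use G in \<open>auto simp: Gamma_def Gog_def\<close>)
  then show ?thesis using A by blast
qed

lemma bij_betw_Gamma: "bij_betw (Gamma n) (ASM n) (Gog n)"
  using inj_on_Gamma Gamma_in_Gog Gog_subset_range_Gamma by (auto simp: bij_betw_def)

section \<open>Row reversal\<close>

lemma rev_rows_carrier [simp]: "A \<in> carrier_mat m n \<Longrightarrow> rev_rows A \<in> carrier_mat m n"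
  by (auto simp: rev_rows_def)

lemma rev_rows_rev_rows [simp]: "rev_rows (rev_rows A) = A"
  by (rule eq_matI) (auto simp: rev_rows_def)

lemma row_rev_rows:
  assumes "i < dim_row A"
  shows "row (rev_rows A) i = row A (dim_row A - 1 - i)"
  using assms by (intro eq_vecI) (auto simp: rev_rows_def)

lemma list_of_vec_col_rev_rows:
  assumes "j < dim_col A"
  shows "list_of_vec (col (rev_rows A) j) = rev (list_of_vec (col A j))"
  using assms
  by (intro nth_equalityI) (auto simp: rev_rows_def list_of_vec_index rev_nth)

lemma rev_rows_in_ASM:
  assumes "A \<in> ASM n"
  shows "rev_rows A \<in> ASM n"
  using assms
  by (auto simp: ASM_def row_rev_rows list_of_vec_col_rev_rows alternating_sign_list_rev)

text \<open>The first \<open>n - i\<close> rows of the reversed matrix are the last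
  \<open>n - i\<close> rows of \<open>A\<close>; since every column has total 1, their sum is 1
  minus the sum of the first \<open>i\<close> rows.\<close>

lemma ones_positions_rev_rows:
  assumes A: "A \<in> ASM n" and "i \<le> n"
  shows "ones_positions n (rev_rows A) (n - i) = {1..n} - ones_positions n A i"
proof -
  have carrier: "A \<in> carrier_mat n n" using A by (simp add: ASM_def)
  have "partial_row_sum (rev_rows A) (n - i) c = 1 - partial_row_sum A i c" if "c < n" for c
  proof -
    have "partial_row_sum (rev_rows A) (n - i) c = (\<Sum>r<n - i. A $$ (n - 1 - r, c))"
      using carrier that by (auto simp: partial_row_sum_def rev_rows_def intro!: sum.cong)
    also have "\<dots> = (\<Sum>r\<in>{i..<n}. A $$ (r, c))"
      by (rule sum.reindex_bij_witness[where i = "\<lambda>r. n - 1 - r" and j = "\<lambda>r. n - 1 - r"]) auto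
    also have "\<dots> = partial_row_sum A n c - partial_row_sum A i c"
      using sum.atLeastLessThan_concat[of 0 i n "\<lambda>r. A $$ (r, c)"] \<open>i \<le> n\<close>
      by (simp add: partial_row_sum_def atLeast0LessThan)
    also have "partial_row_sum A n c = 1" using A that by (auto simp: ASM_iff_sums)
    finally show ?thesis .
  qed
  then have "p \<in> ones_positions n (rev_rows A) (n - i) \<longleftrightarrow> p \<in> {1..n} - ones_positions n A i"
    if "p \<in> {1..n}" for p
    using partial_row_sum_eq_of_bool[OF A \<open>i \<le> n\<close>, of "p - 1"] that
    by (auto simp: ones_positions_def)
  then show ?thesis using ones_positions_subset[of n "rev_rows A"] by blast
qed

section \<open>Two-color pyramids under row reversal\<close>

lemma cube_color_rev_rows:
  assumes A: "A \<in> ASM n" and cube: "(i, j, k) \<in> cubes n"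
  shows "cube_color (Gamma n (rev_rows A)) (n - i, k, j) = opposite (cube_color (Gamma n A) (i, j, k))"
proof -
  from cube have ijk: "1 \<le> j" "j \<le> i" "1 \<le> k" "k \<le> n - i" "i \<le> n" by (auto simp: cubes_def)
  let ?S = "ones_positions n A i"
  let ?T = "ones_positions n (rev_rows A) (n - i)"
  have T: "?T = {1..n} - ?S" using ones_positions_rev_rows[OF A ijk(5)] .
  define a where "a = Gamma n A (i, j)"
  define b where "b = Gamma n (rev_rows A) (n - i, k)"
  have revA: "rev_rows A \<in> ASM n" by (rule rev_rows_in_ASM[OF A])
  have S_enum: "enumerates (\<lambda>j. Gamma n A (i, j)) ?S" "card ?S = i"
    using Gamma_enumerates[OF A] ASM_ones_positions(1)[OF A] ijk by auto
  have T_enum: "enumerates (\<lambda>k. Gamma n (rev_rows A) (n - i, k)) ?T" "card ?T = n - i"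
    using Gamma_enumerates[OF revA] ASM_ones_positions(1)[OF revA] ijk by auto
  have le: "a \<le> c \<longleftrightarrow> j \<le> card (?S \<inter> {..c})" "b \<le> c \<longleftrightarrow> k \<le> card (?T \<inter> {..c})" for c
    using enumerates_le_iff[OF S_enum(1)] enumerates_le_iff[OF T_enum(1)] S_enum(2) T_enum(2) ijk
    by (auto simp: a_def b_def)
  have cards: "card (?S \<inter> {..a}) = j" "card (?T \<inter> {..b}) = k"
    using enumerates_card_atMost[OF S_enum(1)] enumerates_card_atMost[OF T_enum(1)]
      S_enum(2) T_enum(2) ijk
    by (auto simp: a_def b_def)
  have mem: "a \<in> ?S" "b \<in> ?T"
    using enumerates_mem[OF S_enum(1)] enumerates_mem[OF T_enum(1)] S_enum(2) T_enum(2) ijk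
    by (auto simp: a_def b_def)
  have split: "card (?S \<inter> {..c}) + card (?T \<inter> {..c}) = c" if "c \<le> n" for c
  proof -
    have "(?S \<inter> {..c}) \<union> (?T \<inter> {..c}) = {1..c}"
      using that ones_positions_subset[of n A i] by (auto simp: T)
    moreover have "card ((?S \<inter> {..c}) \<union> (?T \<inter> {..c})) = card (?S \<inter> {..c}) + card (?T \<inter> {..c})"
      using T by (intro card_Un_disjoint) auto
    ultimately show ?thesis by simp
  qed
  have bounds: "a \<le> n" "b \<le> n" "a \<noteq> b" using mem T ones_positions_subset[of n A i] by auto
  \<comment> \<open>Exactly \<open>j\<close> of the positions \<open>1, ..., a\<close> lie in
    \<open>?S\<close>, so \<open>a - j\<close> of them lie in \<open>?T\<close>; \<open>k\<close> is
    at most this number iff the \<open>k\<close>-th element \<open>b\<close> of \<open>?T\<close> is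
    at most \<open>a\<close>. The second equivalence exchanges the roles.\<close>
  have "k \<le> a - j \<longleftrightarrow> b \<le> a"
    using split[OF bounds(1)] cards(1) le(2)[of a] by linarith
  moreover have "j \<le> b - k \<longleftrightarrow> a \<le> b"
    using split[OF bounds(2)] cards(2) le(1)[of b] by linarith
  \<comment> \<open>As \<open>a\<close> and \<open>b\<close> differ, exactly one of the two
    comparisons holds, so the colors are opposite.\<close>
  ultimately show ?thesis
    using bounds(3) by (auto simp: cube_color_def a_def b_def)
qed

text \<open>The map is its own inverse: passing from \<open>i\<close> to \<open>n - i\<close> and
  swapping \<open>j\<close> with \<open>k\<close> exchanges the bounds \<open>j \<le> i\<close> and
  \<open>k \<le> n - i\<close>.\<close>

lemma bij_betw_cubes: "bij_betw (\<lambda>(i, j, k). (n - i, k, j)) (cubes n) (cubes n)"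
  by (rule bij_betw_byWitness[where f' = "\<lambda>(i, j, k). (n - i, k, j)"]) (auto simp: cubes_def)

lemma pyramid_rev_rows:
  assumes "A \<in> ASM n"
  shows "pyramid n (Gamma n (rev_rows A)) =
    (\<lambda>((i, j, k), c). ((n - i, k, j), opposite c)) ` pyramid n (Gamma n A)"
proof -
  let ?move = "\<lambda>(i, j, k). (n - i, k, j)"
  let ?H = "Gamma n (rev_rows A)"
  \<comment> \<open>Reindexing the cubes by the move makes both pyramids images of the same index
    set.\<close>
  have "pyramid n ?H = (\<lambda>p. (p, cube_color ?H p)) ` ?move ` cubes n"
    using bij_betw_cubes[of n] by (simp add: pyramid_def bij_betw_def)
  also have "\<dots> = (\<lambda>p. (?move p, opposite (cube_color (Gamma n A) p))) ` cubes n"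
    unfolding image_image
    using cube_color_rev_rows[OF assms] by (intro image_cong) auto
  also have "\<dots> = (\<lambda>((i, j, k), c). ((n - i, k, j), opposite c)) ` pyramid n (Gamma n A)"
    unfolding pyramid_def image_image by (intro image_cong) auto
  finally show ?thesis .
qed

text \<open>Reduces claims about \<open>gog_rev\<close> to \<open>rev_rows\<close>, whose
  involutivity it thus inherits.\<close>

lemma gog_rev_Gamma:
  assumes "A \<in> ASM n"
  shows "gog_rev n (Gamma n A) = Gamma n (rev_rows A)"
  using assms by (simp add: gog_rev_def inv_into_f_f[OF inj_on_Gamma])

theorem mainTheorem9:
  fixes n :: nat
  assumes "n \<ge> 2"
  shows "bij_betw (Gamma n) (ASM n) (Gog n)
    \<and> rev_rows ` ASM n \<subseteq> ASM n
    \<and> (\<forall>G \<in> Gog n. gog_rev n G \<in> Gog n \<and> gog_rev n (gog_rev n G) = G)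
    \<and> (\<forall>G \<in> Gog n. pyramid n (gog_rev n G) =
          (\<lambda>((i, j, k), c). ((n - i, k, j), opposite c)) ` pyramid n G)"
proof (intro conjI ballI)
  show "bij_betw (Gamma n) (ASM n) (Gog n)" by (rule bij_betw_Gamma)
  show "rev_rows ` ASM n \<subseteq> ASM n" using rev_rows_in_ASM by blast
  fix G assume "G \<in> Gog n"
  then obtain A where A: "A \<in> ASM n" and G: "G = Gamma n A"
    using Gog_subset_range_Gamma by blast
  show "gog_rev n G \<in> Gog n" "gog_rev n (gog_rev n G) = G"
    using A by (simp_all add: G gog_rev_Gamma Gamma_in_Gog rev_rows_in_ASM)
  show "pyramid n (gog_rev n G) =
      (\<lambda>((i, j, k), c). ((n - i, k, j), opposite c)) ` pyramid n G"
    using pyramid_rev_rows[OF A] by (simp add: G gog_rev_Gamma[OF A])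
qed

end
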